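(* Let $m\ge1$ and $X=\{x_0,x_1,\dots,x_m\}$. For any $c\in\mathbb{R}^m_{LC}\langle\langle X\rangle\rangle$ with growth constants $K_c,M_c>0$, i.e., $|(c,\eta)|\le K_cM_c^{|\eta|}|\eta|!$ for all $\eta\in X^*$, it follows that $$|(c^{-1},\eta)|\le K\,(\mathcal{A}(K_c)M_c)^{|\eta|}\,|\eta|!,\qquad\forall\eta\in X^*,$$ for some $K>0$, where $$\mathcal{A}(K_c)=\frac{1}{1-mK_c\ln\left(1+\frac{1}{mK_c}\right)}.$$ Therefore $c^{-1}\in\mathbb{R}^m_{LC}\langle\langle X\rangle\rangle$. Furthermore, no geometric growth constant smaller than $\mathcal{A}(K_c)M_c$ can satisfy this bound for the whole class of series with growth constants $K_c,M_c$: for all $K_c,M_c>0$ and every $0<M'<\mathcal{A}(K_c)M_c$ there is a series $c\in\mathbb{R}^m_{LC}\langle\langle X\rangle\rangle$ with $|(c,\eta)|\le K_cM_c^{|\eta|}|\eta|!$ for all $\eta$ such that there is no $K>0$ with $|(c^{-1},\eta)|\le K(M')^{|\eta|}|\eta|!$ for all $\eta\in X^*$. Hence the radius of convergence for the composition inverse operation is $1/(\mathcal{A}(K_c)M_c(m+1))$.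
   Context: $X^*$ is the monoid of words over the alphabet $X$ of noncommuting letters, including the empty word $\emptyset$; $|\eta|$ is word length. $\mathbb{R}^m\langle\langle X\rangle\rangle$ is the set of formal power series $c:X^*\to\mathbb{R}^m$, $c=\sum_\eta(c,\eta)\eta$, with component series $c_i$; $|z|=\max_i|z_i|$ for $z\in\mathbb{R}^m$. $\mathbb{R}^m_{LC}\langle\langle X\rangle\rangle$ (locally convergent series) is the set of $c$ for which there are $K_c,M_c>0$ (growth constants; $M_c$ is the geometric growth constant) with $|(c,\eta)|\le K_cM_c^{|\eta|}|\eta|!$ for all $\eta\in X^*$. When $M$ is the smallest geometric growth constant valid for a class of series, the number $1/(M(m+1))$ is called the radius of convergence for the class. The shuffle product $\sqcup\!\sqcup$ is the bilinear product with $(x_i\eta)\sqcup\!\sqcup(x_j\xi)=x_i(\eta\sqcup\!\sqcup(x_j\xi))+x_j((x_i\eta)\sqcup\!\sqcup\xi)$ and $\eta\sqcup\!\sqcup\emptyset=\emptyset\sqcup\!\sqcup\eta=\eta$. The modified composition product of $c,d\in\mathbb{R}^m\langle\langle X\rangle\rangle$ is $c\,\tilde\circ\,d=\sum_{\eta\in X^*}(c,\eta)\,\phi_d(\eta)(1)$, where $\phi_d$ is the continuous (in the ultrametric sense) algebra homomorphism from $\mathbb{R}\langle\langle X\rangle\rangle$ to $\mathrm{End}(\mathbb{R}\langle\langle X\rangle\rangle)$ with $\phi_d(x_i\eta)=\phi_d(x_i)\circ\phi_d(\eta)$, $\phi_d(x_i)(e)=x_ie+x_0(d_i\sqcup\!\sqcup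 e)$ for $i=0,\dots,m$ with $d_0:=0$, and $\phi_d(\emptyset)=\mathrm{id}$. On formal elements $c_\delta=\delta+c$, $c\in\mathbb{R}^m\langle\langle X\rangle\rangle$ ($\delta$ a symbol representing the identity operator), the product $c_\delta\circ d_\delta=\delta+d+c\,\tilde\circ\,d$ defines a group with identity $\delta$. The composition inverse $c^{-1}$ of $c$ is the series with $(\delta+c)^{-1}=\delta+c^{-1}$ in this group; equivalently, $c^{-1}$ is the unique series satisfying $c^{-1}=(-c)\,\tilde\circ\,c^{-1}$. *)

theory Defs
  imports "HOL-Analysis.Analysis" "HOL-Algebra.Group" "HOL-Library.Multiset"
    "HOL-Library.Groups_Big_Fun"
begin

text \<open>
  The number of inputs \<open>m\<close> is \<open>CARD('m)\<close> for a finite index type \<open>'m\<close>. The alphabet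
  \<open>{x\<^sub>0, x\<^sub>1, \<dots>, x\<^sub>m}\<close> is \<open>'m option\<close>, where \<open>None\<close> is the distinguished letter \<open>x\<^sub>0\<close>
  and \<open>Some i\<close> is \<open>x\<^sub>i\<close>. Scalar series map words to \<open>real\<close>, and elements of
  \<open>\<real>\<^sup>m\<langle>\<langle>X\<rangle>\<rangle>\<close> map words to \<open>real ^ 'm\<close>.
\<close>

type_synonym 'm word = "'m option list"
type_synonym 'm sseries = "'m word \<Rightarrow> real"
type_synonym 'm series = "'m word \<Rightarrow> real ^ 'm"


subsection \<open>Shuffle product\<close>

text \<open>The product of two words is a multiset of words: the multiplicity of a word is its coefficient.\<close>

fun shuffle_word :: "'a list \<Rightarrow> 'a list \<Rightarrow> 'a list multiset" where
  "shuffle_word [] \<xi> = {#\<xi>#}"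
| "shuffle_word (a # \<eta>) [] = {#a # \<eta>#}"
| "shuffle_word (a # \<eta>) (b # \<xi>) =
     image_mset ((#) a) (shuffle_word \<eta> (b # \<xi>)) + image_mset ((#) b) (shuffle_word (a # \<eta>) \<xi>)"

definition shuffle :: "'m sseries \<Rightarrow> 'm sseries \<Rightarrow> 'm sseries" where
  "shuffle e f = (\<lambda>\<zeta>. Sum_any (\<lambda>(\<eta>, \<xi>). e \<eta> * f \<xi> * real (count (shuffle_word \<eta> \<xi>) \<zeta>)))"

lemma length_shuffle_word:
  "\<zeta> \<in># shuffle_word \<eta> \<xi> \<Longrightarrow> length \<zeta> = length \<eta> + length \<xi>"
  by (induction \<eta> \<xi> arbitrary: \<zeta> rule: shuffle_word.induct) auto

text \<open>\<^const>\<open>Sum_any\<close> is zero on infinite supports; the sum above always has finite support.\<close>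

lemma finite_shuffle_support:
  fixes e f :: "('m::finite) sseries"
  shows "finite {p. (case p of (\<eta>, \<xi>) \<Rightarrow> e \<eta> * f \<xi> * real (count (shuffle_word \<eta> \<xi>) \<zeta>)) \<noteq> 0}"
proof (rule finite_subset)
  let ?W = "{\<eta> :: 'm word. set \<eta> \<subseteq> UNIV \<and> length \<eta> \<le> length \<zeta>}"
  show "{p. (case p of (\<eta>, \<xi>) \<Rightarrow> e \<eta> * f \<xi> * real (count (shuffle_word \<eta> \<xi>) \<zeta>)) \<noteq> 0} \<subseteq> ?W \<times> ?W"
    using length_shuffle_word[of \<zeta>] by (fastforce simp: count_eq_zero_iff)
  show "finite (?W \<times> ?W)"
    using finite_lists_length_le[of "UNIV :: 'm option set" "length \<zeta>"] by simp
qed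


subsection \<open>Modified composition product\<close>

definition one_series :: "'m sseries" where
  "one_series = (\<lambda>\<eta>. if \<eta> = [] then 1 else 0)"

text \<open>Left concatenation \<open>e \<mapsto> x\<^sub>a e\<close>.\<close>

definition lconcat :: "'m option \<Rightarrow> 'm sseries \<Rightarrow> 'm sseries" where
  "lconcat a e = (\<lambda>\<eta>. case \<eta> of [] \<Rightarrow> 0 | b # \<xi> \<Rightarrow> if b = a then e \<xi> else 0)"

text \<open>The component \<open>d\<^sub>i\<close>, with the convention \<open>d\<^sub>0 = 0\<close>.\<close>

definition component :: "('m::finite) series \<Rightarrow> 'm option \<Rightarrow> 'm sseries" where
  "component d a = (\<lambda>\<eta>. case a of None \<Rightarrow> 0 | Some i \<Rightarrow> d \<eta> $ i)"

definition phi_letter :: "('m::finite) series \<Rightarrow> 'm option \<Rightarrow> 'm sseries \<Rightarrow> 'm sseries" where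
  "phi_letter d a e = (\<lambda>\<eta>. lconcat a e \<eta> + lconcat None (shuffle (component d a) e) \<eta>)"

primrec phi :: "('m::finite) series \<Rightarrow> 'm word \<Rightarrow> 'm sseries \<Rightarrow> 'm sseries" where
  "phi d [] = id"
| "phi d (a # \<eta>) = phi_letter d a \<circ> phi d \<eta>"

definition mod_comp :: "('m::finite) series \<Rightarrow> 'm series \<Rightarrow> 'm series" where
  "mod_comp c d = (\<lambda>\<xi>. Sum_any (\<lambda>\<eta>. phi d \<eta> one_series \<xi> *\<^sub>R c \<eta>))"

text \<open>The sum over all words is locally finite, so \<^const>\<open>Sum_any\<close> computes it.\<close>

lemma phi_eq_0:
  "length \<xi> < length \<eta> \<Longrightarrow> phi d \<eta> one_series \<xi> = 0"
proof (induction \<eta> arbitrary: \<xi>)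
  case (Cons a \<eta>)
  have sh: "shuffle f (phi d \<eta> one_series) \<zeta> = 0" if "length \<zeta> < length \<eta>" for f \<zeta>
  proof -
    have "f \<alpha> * phi d \<eta> one_series \<beta> * real (count (shuffle_word \<alpha> \<beta>) \<zeta>) = 0" for \<alpha> \<beta>
    proof (cases "\<zeta> \<in># shuffle_word \<alpha> \<beta>")
      case True
      then show ?thesis using Cons.IH[of \<beta>] length_shuffle_word[of \<zeta> \<alpha> \<beta>] that by simp
    next
      case False
      then show ?thesis by (simp add: count_eq_zero_iff)
    qed
    then have "(\<lambda>(\<alpha>, \<beta>). f \<alpha> * phi d \<eta> one_series \<beta> * real (count (shuffle_word \<alpha> \<beta>) \<zeta>)) = (\<lambda>_. 0)"
      unfolding fun_eq_iff split_paired_All case_prod_conv by blast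
    then show ?thesis by (simp add: shuffle_def)
  qed
  show ?case
    using Cons.prems Cons.IH sh
    by (cases \<xi>) (auto simp: phi_letter_def lconcat_def)
qed simp

lemma finite_mod_comp_support:
  fixes c d :: "('m::finite) series"
  shows "finite {\<eta>. phi d \<eta> one_series \<xi> *\<^sub>R c \<eta> \<noteq> 0}"
proof (rule finite_subset)
  show "{\<eta>. phi d \<eta> one_series \<xi> *\<^sub>R c \<eta> \<noteq> 0} \<subseteq> {\<eta>. set \<eta> \<subseteq> UNIV \<and> length \<eta> \<le> length \<xi>}"
    using phi_eq_0[of \<xi> _ d] by (auto simp: not_less[symmetric])
  show "finite {\<eta> :: 'm word. set \<eta> \<subseteq> UNIV \<and> length \<eta> \<le> length \<xi>}"
    by (rule finite_lists_length_le) simp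
qed


subsection \<open>Composition inverse\<close>

text \<open>
  The group of formal elements \<open>\<delta> + c\<close> with
  \<open>(\<delta> + c) \<circ> (\<delta> + d) = \<delta> + (d + mod_comp c d)\<close>. The element \<open>\<delta> + c\<close> is represented by
  \<open>c\<close>, so the unit \<open>\<delta>\<close> is the zero series and the group inverse of \<open>c\<close> is the series
  \<open>c\<^sup>-\<^sup>1\<close> with \<open>(\<delta> + c)\<^sup>-\<^sup>1 = \<delta> + c\<^sup>-\<^sup>1\<close>.
\<close>

definition delta_group :: "('m::finite) series monoid" where
  "delta_group =
     \<lparr>carrier = UNIV, mult = (\<lambda>c d \<eta>. d \<eta> + mod_comp c d \<eta>), one = (\<lambda>\<eta>. 0)\<rparr>"

definition comp_inverse :: "('m::finite) series \<Rightarrow> 'm series" where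
  "comp_inverse c = m_inv delta_group c"


subsection \<open>Growth constants and radius of convergence\<close>

text \<open>\<^const>\<open>infnorm\<close> on \<open>real ^ 'm\<close> is the maximum of the absolute values of the components.\<close>

definition growth_bound :: "real \<Rightarrow> real \<Rightarrow> ('m::finite) series \<Rightarrow> bool" where
  "growth_bound K M c \<longleftrightarrow> (\<forall>\<eta>. infnorm (c \<eta>) \<le> K * M ^ length \<eta> * fact (length \<eta>))"

definition locally_convergent :: "('m::finite) series set" where
  "locally_convergent = {c. \<exists>K>0. \<exists>M>0. growth_bound K M c}"

text \<open>
  \<open>M\<close> is valid for a class if every member satisfies a growth bound with geometric
  constant \<open>M\<close>; the other constant \<open>K\<close> may depend on the member.
\<close>

definition geometric_constant :: "('m::finite) series set \<Rightarrow> real \<Rightarrow> bool" where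
  "geometric_constant C M \<longleftrightarrow> M > 0 \<and> (\<forall>c\<in>C. \<exists>K>0. growth_bound K M c)"

definition has_radius_of_convergence :: "('m::finite) series set \<Rightarrow> real \<Rightarrow> bool" where
  "has_radius_of_convergence C r \<longleftrightarrow>
     (\<exists>M. geometric_constant C M \<and> (\<forall>M'. geometric_constant C M' \<longrightarrow> M \<le> M') \<and>
          r = 1 / (M * (real CARD('m) + 1)))"

definition inverse_growth_factor :: "nat \<Rightarrow> real \<Rightarrow> real" where
  "inverse_growth_factor m K = 1 / (1 - real m * K * ln (1 + 1 / (real m * K)))"

end

theory Submission imports Defs begin

text \<open>
  Left derivatives \<open>(D\<^sub>x e) \<eta> = e (x \<eta>)\<close> act on shuffles as derivations, and the composition
  satisfies \<open>D\<^sub>i (a \<circ> d) = (D\<^sub>i a) \<circ> d\<close> and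
  \<open>D\<^sub>0 (a \<circ> d) = (D\<^sub>0 a) \<circ> d + \<Sum>\<^sub>i d\<^sub>i \<squnion> ((D\<^sub>i a) \<circ> d)\<close> (with \<open>\<squnion>\<close> the shuffle), so
  identities between compositions follow by induction on word length. In particular the group axioms hold and
  \<open>y = c\<^sup>-\<^sup>1\<close> satisfies \<open>y = (-c) \<circ> y\<close>.

  Taking absolute values in this recursion, \<open>|y|\<close> is dominated on words of length \<open>n\<close> by the coefficient
  at \<open>x\<^sub>0\<^sup>n\<close> of the inverse of \<open>- \<Sum> K M\<^bsup>|\<eta>|\<^esup> |\<eta>|! \<eta>\<close>. Let \<open>G\<close> be \<open>m\<close> times the exponential
  generating function of these coefficients and \<open>\<kappa> = m K\<close>. On powers of \<open>x\<^sub>0\<close>, shuffles are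
  products of exponential generating functions, and the recursion becomes \<open>G (1 - P) = \<kappa>\<close>,
  \<open>P' = M (1 + G)\<close>, \<open>P 0 = 0\<close>. The solution reaches \<open>P = 1\<close> at
  \<open>T = (1 - \<kappa> ln (1 + 1 / \<kappa>)) / M\<close>, which is the reciprocal of the asserted growth constant. The
  coefficients of \<open>P\<close> are nonnegative and \<open>\<Sum> P\<^sub>j T\<^sup>j \<le> 1\<close>, so the renewal equation
  \<open>G = \<kappa> + P G\<close> gives \<open>G\<^sub>n T\<^sup>n \<le> \<kappa>\<close>; and \<open>G\<close> cannot be continued past \<open>T\<close>.
\<close>

subsection \<open>Shuffle and composition through left derivatives\<close>

definition words_upto :: "nat \<Rightarrow> ('m::finite) word set" where
  "words_upto n = {\<eta>. length \<eta> \<le> n}"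

lemma finite_words_upto [simp]: "finite (words_upto n)"
  using finite_lists_length_le[of "UNIV :: 'm::finite option set" n]
  by (simp add: words_upto_def)

lemma sum_words_upto_0:
  fixes f :: "('m::finite) word \<Rightarrow> real"
  shows "sum f (words_upto 0) = f []"
proof -
  have "words_upto 0 = {[] :: 'm word}" by (auto simp: words_upto_def)
  then show ?thesis by simp
qed

lemma sum_words_upto_Suc:
  fixes f :: "('m::finite) word \<Rightarrow> real"
  shows "sum f (words_upto (Suc n)) = f [] + (\<Sum>a\<in>UNIV. \<Sum>\<eta>\<in>words_upto n. f (a # \<eta>))"
proof -
  let ?g = "\<lambda>(a, \<eta>). a # \<eta> :: 'm word"
  have eq: "(words_upto (Suc n) :: 'm word set) = insert [] (?g ` (UNIV \<times> words_upto n))" (is "?L = ?R")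
  proof (rule Set.set_eqI)
    fix x show "x \<in> ?L \<longleftrightarrow> x \<in> ?R" by (cases x) (auto simp: words_upto_def)
  qed
  have inj: "inj_on ?g (UNIV \<times> words_upto n)" by (auto simp: inj_on_def)
  have "sum f ?R = f [] + sum f (?g ` (UNIV \<times> words_upto n))"
    by (rule sum.insert) auto
  also have "sum f (?g ` (UNIV \<times> words_upto n)) = (\<Sum>(a, \<eta>)\<in>UNIV \<times> words_upto n. f (a # \<eta>))"
    by (subst sum.reindex[OF inj]) (simp add: case_prod_unfold)
  also have "\<dots> = (\<Sum>a\<in>UNIV. \<Sum>\<eta>\<in>words_upto n. f (a # \<eta>))"
    by (simp add: sum.cartesian_product)
  finally show ?thesis unfolding eq .
qed

lemma sum_option: "sum f (UNIV :: ('m::finite) option set) = f None + (\<Sum>i\<in>UNIV. f (Some i))"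
  by (simp add: UNIV_option_conv sum.reindex)

section \<open>Left derivatives and the shuffle algebra\<close>

definition lderiv :: "'m option \<Rightarrow> 'm sseries \<Rightarrow> 'm sseries" where
  "lderiv a e = (\<lambda>\<eta>. e (a # \<eta>))"

text \<open>The two truncation levels are independent because \<open>shuffle_Cons\<close> cuts one
  factor at length \<open>n\<close> and the other at \<open>Suc n\<close>.\<close>

lemma shuffle_eq_sum:
  fixes e f :: "('m::finite) sseries"
  assumes "length \<zeta> \<le> k" "length \<zeta> \<le> l"
  shows "shuffle e f \<zeta> =
    (\<Sum>\<eta>\<in>words_upto k. \<Sum>\<xi>\<in>words_upto l. e \<eta> * f \<xi> * real (count (shuffle_word \<eta> \<xi>) \<zeta>))"
proof -
  have "shuffle e f \<zeta> = (\<Sum>(\<eta>, \<xi>)\<in>words_upto k \<times> words_upto l.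
      e \<eta> * f \<xi> * real (count (shuffle_word \<eta> \<xi>) \<zeta>))"
    unfolding shuffle_def
  proof (rule Sum_any.expand_superset)
    show "{a. (case a of (\<eta>, \<xi>) \<Rightarrow> e \<eta> * f \<xi> * real (count (shuffle_word \<eta> \<xi>) \<zeta>)) \<noteq> 0}
        \<subseteq> words_upto k \<times> words_upto l"
      using length_shuffle_word[of \<zeta>] assms
      by (fastforce simp: count_eq_zero_iff words_upto_def)
  qed simp
  then show ?thesis by (simp add: sum.cartesian_product)
qed

lemma shuffle_Nil: "shuffle e f [] = e [] * f []" for e f :: "('m::finite) sseries"
  by (simp add: shuffle_eq_sum[of _ 0 0] sum_words_upto_0)

lemma count_image_Cons: "count (image_mset ((#) a) M) (b # \<zeta>) = (if a = b then count M \<zeta> else 0)"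
  by (induction M) auto

lemma count_shuffle_word_Cons:
  "count (shuffle_word \<eta> \<xi>) (a # \<zeta>) =
    (case \<eta> of [] \<Rightarrow> 0 | b # \<eta>' \<Rightarrow> if b = a then count (shuffle_word \<eta>' \<xi>) \<zeta> else 0) +
    (case \<xi> of [] \<Rightarrow> 0 | b # \<xi>' \<Rightarrow> if b = a then count (shuffle_word \<eta> \<xi>') \<zeta> else 0)"
proof -
  have r: "shuffle_word \<alpha> [] = {#\<alpha>#}" for \<alpha> :: "'a list" by (cases \<alpha>) auto
  show ?thesis
    by (cases \<eta>; cases \<xi>) (auto simp: count_image_Cons r)
qed

lemma sum_words_upto_Suc_letter:
  fixes F :: "('m::finite) word \<Rightarrow> real"
  shows "(\<Sum>\<eta>\<in>words_upto (Suc n). F \<eta> * real (case \<eta> of [] \<Rightarrow> 0 | b # \<eta>' \<Rightarrow> if b = a then G \<eta>' else 0))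
    = (\<Sum>\<eta>\<in>words_upto n. F (a # \<eta>) * real (G \<eta>))"
proof -
  have "(\<Sum>\<eta>\<in>words_upto n. F (b # \<eta>) * real (if b = a then G \<eta> else 0)) =
      (if b = a then \<Sum>\<eta>\<in>words_upto n. F (a # \<eta>) * real (G \<eta>) else 0)" for b
    by auto
  then show ?thesis by (simp add: sum_words_upto_Suc)
qed

text \<open>Leibniz rule: the first letter of an interleaving comes from exactly one of the two
  factors.\<close>

lemma shuffle_Cons:
  fixes e f :: "('m::finite) sseries"
  shows "shuffle e f (a # \<zeta>) = shuffle (lderiv a e) f \<zeta> + shuffle e (lderiv a f) \<zeta>"
proof -
  let ?n = "length \<zeta>" and ?c = "\<lambda>\<eta> \<xi> \<zeta>. count (shuffle_word \<eta> \<xi>) \<zeta>"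
  let ?W = "words_upto :: nat \<Rightarrow> 'm word set"
  have "shuffle e f (a # \<zeta>) =
      (\<Sum>\<eta>\<in>?W (Suc ?n). \<Sum>\<xi>\<in>?W (Suc ?n). e \<eta> * f \<xi> *
        real (case \<eta> of [] \<Rightarrow> 0 | b # \<eta>' \<Rightarrow> if b = a then ?c \<eta>' \<xi> \<zeta> else 0)) +
      (\<Sum>\<eta>\<in>?W (Suc ?n). \<Sum>\<xi>\<in>?W (Suc ?n). e \<eta> * f \<xi> *
        real (case \<xi> of [] \<Rightarrow> 0 | b # \<xi>' \<Rightarrow> if b = a then ?c \<eta> \<xi>' \<zeta> else 0))"
    by (simp add: shuffle_eq_sum[of "a # \<zeta>" "Suc ?n" "Suc ?n"] count_shuffle_word_Cons
        distrib_left sum.distrib)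
  also have "(\<Sum>\<eta>\<in>?W (Suc ?n). \<Sum>\<xi>\<in>?W (Suc ?n). e \<eta> * f \<xi> *
        real (case \<eta> of [] \<Rightarrow> 0 | b # \<eta>' \<Rightarrow> if b = a then ?c \<eta>' \<xi> \<zeta> else 0)) =
      shuffle (lderiv a e) f \<zeta>"
    unfolding shuffle_eq_sum[of \<zeta> "?n" "Suc ?n", simplified] lderiv_def
    by (subst sum.swap, subst sum_words_upto_Suc_letter, subst sum.swap) simp
  also have "(\<Sum>\<eta>\<in>?W (Suc ?n). \<Sum>\<xi>\<in>?W (Suc ?n). e \<eta> * f \<xi> *
        real (case \<xi> of [] \<Rightarrow> 0 | b # \<xi>' \<Rightarrow> if b = a then ?c \<eta> \<xi>' \<zeta> else 0)) =
      shuffle e (lderiv a f) \<zeta>"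
    unfolding shuffle_eq_sum[of \<zeta> "Suc ?n" "?n", simplified] lderiv_def
    by (subst sum_words_upto_Suc_letter) simp
  finally show ?thesis .
qed

text \<open>A word occurs only in shuffles of words no longer than itself. This lets an induction
  hypothesis limited by word length be applied inside a shuffle.\<close>

lemma shuffle_cong:
  fixes e f :: "('m::finite) sseries"
  assumes "\<And>\<eta>. length \<eta> \<le> length \<zeta> \<Longrightarrow> e \<eta> = e' \<eta>" "\<And>\<eta>. length \<eta> \<le> length \<zeta> \<Longrightarrow> f \<eta> = f' \<eta>"
  shows "shuffle e f \<zeta> = shuffle e' f' \<zeta>"
  unfolding shuffle_eq_sum[OF order_refl order_refl]
  by (intro sum.cong) (auto simp: words_upto_def assms)

lemma shuffle_commute: "shuffle e f \<zeta> = shuffle f e \<zeta>" for e f :: "('m::finite) sseries"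
  by (induction \<zeta> arbitrary: e f) (simp_all add: shuffle_Nil shuffle_Cons)

lemma shuffle_sum_right:
  fixes e :: "('m::finite) sseries"
  shows "shuffle e (\<lambda>\<eta>. \<Sum>i\<in>I. w i * f i \<eta>) \<zeta> = (\<Sum>i\<in>I. w i * shuffle e (f i) \<zeta>)"
  by (induction \<zeta> arbitrary: e f)
    (simp_all add: shuffle_Nil shuffle_Cons lderiv_def sum.distrib sum_distrib_left distrib_left ac_simps)

lemma shuffle_add_right:
  "shuffle e (\<lambda>\<eta>. f \<eta> + g \<eta>) \<zeta> = shuffle e f \<zeta> + shuffle e g \<zeta>" for e :: "('m::finite) sseries"
  by (induction \<zeta> arbitrary: e f g) (simp_all add: shuffle_Nil shuffle_Cons lderiv_def algebra_simps)

lemma shuffle_add_left: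
  "shuffle (\<lambda>\<eta>. f \<eta> + g \<eta>) e \<zeta> = shuffle f e \<zeta> + shuffle g e \<zeta>" for e :: "('m::finite) sseries"
  by (simp add: shuffle_commute[of _ e] shuffle_add_right)

lemma shuffle_sum_left:
  fixes e :: "('m::finite) sseries"
  shows "shuffle (\<lambda>\<eta>. \<Sum>i\<in>I. f i \<eta>) e \<zeta> = (\<Sum>i\<in>I. shuffle (f i) e \<zeta>)"
  using shuffle_sum_right[of e "\<lambda>_. 1" f I \<zeta>] by (simp add: shuffle_commute[of _ e])

lemma lderiv_shuffle:
  "lderiv a (shuffle e f) = (\<lambda>\<zeta>. shuffle (lderiv a e) f \<zeta> + shuffle e (lderiv a f) \<zeta>)"
  for e f :: "('m::finite) sseries"
  unfolding lderiv_def[of a "shuffle e f"] by (simp add: shuffle_Cons)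

text \<open>Both sides obey the same Leibniz recursion and agree at the empty word.\<close>

lemma shuffle_assoc:
  "shuffle (shuffle e f) g \<zeta> = shuffle e (shuffle f g) \<zeta>" for e f g :: "('m::finite) sseries"
  by (induction \<zeta> arbitrary: e f g)
    (simp_all add: shuffle_Nil shuffle_Cons lderiv_shuffle shuffle_add_left shuffle_add_right)

lemma shuffle_left_commute:
  "shuffle e (shuffle f g) \<zeta> = shuffle f (shuffle e g) \<zeta>" for e f g :: "('m::finite) sseries"
  by (metis (no_types, lifting) ext shuffle_assoc shuffle_commute)

section \<open>Composition of a scalar series with a vector series\<close>

definition scomp :: "('m::finite) sseries \<Rightarrow> 'm series \<Rightarrow> 'm sseries" where
  "scomp a d = (\<lambda>\<xi>. Sum_any (\<lambda>\<eta>. phi d \<eta> one_series \<xi> * a \<eta>))"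

lemma scomp_eq_sum:
  assumes "length \<xi> \<le> n"
  shows "scomp a d \<xi> = (\<Sum>\<eta>\<in>words_upto n. a \<eta> * phi d \<eta> one_series \<xi>)"
proof -
  have "scomp a d \<xi> = (\<Sum>\<eta>\<in>words_upto n. phi d \<eta> one_series \<xi> * a \<eta>)"
    unfolding scomp_def
  proof (rule Sum_any.expand_superset)
    show "{\<eta>. phi d \<eta> one_series \<xi> * a \<eta> \<noteq> 0} \<subseteq> words_upto n"
      using phi_eq_0[of \<xi> _ d] assms unfolding words_upto_def
      by (metis (mono_tags, lifting) Collect_mono le_trans linorder_not_less mult_eq_0_iff)
  qed simp
  then show ?thesis by (simp add: mult.commute)
qed

text \<open>Composition is linear in its left argument, so it may be studied one scalar component at
  a time.\<close>

lemma mod_comp_component: "mod_comp c d \<xi> $ i = scomp (\<lambda>\<eta>. c \<eta> $ i) d \<xi>"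
proof -
  have "mod_comp c d \<xi> = (\<Sum>\<eta>\<in>words_upto (length \<xi>). phi d \<eta> one_series \<xi> *\<^sub>R c \<eta>)"
    unfolding mod_comp_def
  proof (rule Sum_any.expand_superset)
    show "{\<eta>. phi d \<eta> one_series \<xi> *\<^sub>R c \<eta> \<noteq> 0} \<subseteq> words_upto (length \<xi>)"
      using phi_eq_0[of \<xi> _ d] unfolding words_upto_def
      by (metis (mono_tags, lifting) Collect_mono linorder_not_less scaleR_eq_0_iff)
  qed simp
  then show ?thesis by (simp add: scomp_eq_sum[OF order_refl] sum_component mult.commute)
qed

lemma scomp_Nil: "scomp a d [] = a []"
  by (simp add: scomp_eq_sum[of _ 0] sum_words_upto_0 one_series_def)

abbreviation comp_of :: "('m::finite) series \<Rightarrow> 'm \<Rightarrow> 'm sseries" where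
  "comp_of d i \<equiv> (\<lambda>\<eta>. d \<eta> $ i)"

lemma phi_Cons_None: "phi d (b # \<eta>) e (None # \<zeta>) =
   (if b = None then phi d \<eta> e \<zeta> else 0) + shuffle (component d b) (phi d \<eta> e) \<zeta>"
  by (simp add: phi_letter_def lconcat_def)

lemma phi_Cons_Some: "phi d (b # \<eta>) e (Some i # \<zeta>) = (if b = Some i then phi d \<eta> e \<zeta> else 0)"
  by (auto simp add: phi_letter_def lconcat_def)

text \<open>In \<open>phi_letter\<close> the shuffle term always begins with x_0, so only the left
  concatenation yields words beginning with another letter.\<close>

lemma scomp_Some: "scomp a d (Some i # \<zeta>) = scomp (lderiv (Some i) a) d \<zeta>"
proof -
  have "(\<Sum>\<eta>\<in>words_upto n. a (b # \<eta>) * (if b = Some i then phi d \<eta> one_series \<zeta> else 0)) =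
      (if b = Some i then \<Sum>\<eta>\<in>words_upto n. a (Some i # \<eta>) * phi d \<eta> one_series \<zeta> else 0)" for b n
    by auto
  then show ?thesis
    by (simp add: scomp_eq_sum[of "_ # _", OF order_refl] scomp_eq_sum[of \<zeta>, OF order_refl]
        sum_words_upto_Suc phi_Cons_Some lderiv_def del: phi.simps(2))
      (simp add: one_series_def)
qed

text \<open>Each x_i with i > 0 contributes its shuffle term, which begins with x_0; x_0 itself
  contributes by concatenation alone, since d_0 = 0.\<close>

lemma scomp_None:
  "scomp a d (None # \<zeta>) = scomp (lderiv None a) d \<zeta> +
     (\<Sum>i\<in>UNIV. shuffle (comp_of d i) (scomp (lderiv (Some i) a) d) \<zeta>)"
proof -
  let ?n = "length \<zeta>"
  let ?W = "words_upto ?n"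
  \<comment> \<open>\<open>scomp\<close> is first replaced by a finite sum that agrees with it up to
    the length of \<open>\<zeta>\<close>; linearity of the shuffle then applies.\<close>
  have sh: "(\<Sum>\<eta>\<in>?W. a (b # \<eta>) * shuffle f (phi d \<eta> one_series) \<zeta>) =
      shuffle f (scomp (lderiv b a) d) \<zeta>" for b f
  proof -
    have "shuffle f (scomp (lderiv b a) d) \<zeta> =
        shuffle f (\<lambda>\<xi>. \<Sum>\<eta>\<in>?W. a (b # \<eta>) * phi d \<eta> one_series \<xi>) \<zeta>"
      by (rule shuffle_cong) (simp_all add: scomp_eq_sum[of _ ?n] lderiv_def)
    then show ?thesis by (simp add: shuffle_sum_right)
  qed
  have zero: "shuffle (component d None) f \<zeta> = 0" for f
    by (simp add: component_def shuffle_eq_sum[OF order_refl order_refl])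
  have comp: "component d (Some i) = comp_of d i" for i
    by (simp add: component_def)
  have dl: "(\<Sum>\<eta>\<in>?W. a (b # \<eta>) * (if b = None then phi d \<eta> one_series \<zeta> else 0)) =
      (if b = None then scomp (lderiv None a) d \<zeta> else 0)" for b
    by (cases b) (simp_all add: scomp_eq_sum[of \<zeta>, OF order_refl] lderiv_def)
  have "scomp a d (None # \<zeta>) =
     (\<Sum>b\<in>UNIV. \<Sum>\<eta>\<in>?W. a (b # \<eta>) * ((if b = None then phi d \<eta> one_series \<zeta> else 0) +
        shuffle (component d b) (phi d \<eta> one_series) \<zeta>))"
    by (simp add: scomp_eq_sum[of "_ # _", OF order_refl] sum_words_upto_Suc phi_Cons_None
         del: phi.simps(2)) (simp add: one_series_def)
  also have "\<dots> = (\<Sum>b\<in>UNIV. (if b = None then scomp (lderiv None a) d \<zeta> else 0) +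
       shuffle (component d b) (scomp (lderiv b a) d) \<zeta>)"
    by (simp add: distrib_left sum.distrib dl sh)
  finally show ?thesis
    by (simp add: sum_option zero comp)
qed

subsection \<open>The group of formal elements\<close>

lemma scomp_add: "scomp (\<lambda>\<eta>. a \<eta> + b \<eta>) d \<zeta> = scomp a d \<zeta> + scomp b d \<zeta>"
  by (simp add: scomp_eq_sum[OF order_refl] sum.distrib distrib_right)

lemma scomp_sum: "scomp (\<lambda>\<eta>. \<Sum>i\<in>I. f i \<eta>) d \<zeta> = (\<Sum>i\<in>I. scomp (f i) d \<zeta>)"
  unfolding scomp_eq_sum[OF order_refl] sum_distrib_right by (rule sum.swap)

lemma scomp_uminus: "scomp (\<lambda>\<eta>. - a \<eta>) d \<zeta> = - scomp a d \<zeta>"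
  by (simp add: scomp_eq_sum[OF order_refl] sum_negf)

lemma lderiv_scomp_Some: "lderiv (Some i) (scomp a d) = scomp (lderiv (Some i) a) d"
  unfolding lderiv_def[of _ "scomp a d"] by (simp add: scomp_Some)

lemma lderiv_scomp_None: "lderiv None (scomp a d) = (\<lambda>\<zeta>. scomp (lderiv None a) d \<zeta> +
     (\<Sum>i\<in>UNIV. shuffle (comp_of d i) (scomp (lderiv (Some i) a) d) \<zeta>))"
  unfolding lderiv_def[of _ "scomp a d"] by (simp add: scomp_None)

text \<open>Both sides have the same left derivatives up to shorter words. The homomorphism property
  serves \<open>scomp_assoc\<close>, where \<open>scomp_None\<close> puts shuffles inside a
  composition.\<close>

lemma scomp_shuffle: "scomp (shuffle a b) d \<zeta> = shuffle (scomp a d) (scomp b d) \<zeta>"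
proof (induction "length \<zeta>" arbitrary: a b \<zeta> rule: less_induct)
  case less
  show ?case
  proof (cases \<zeta>)
    case Nil
    then show ?thesis by (simp add: scomp_Nil shuffle_Nil)
  next
    case (Cons x \<xi>)
    have IH: "scomp (shuffle e f) d \<eta> = shuffle (scomp e d) (scomp f d) \<eta>"
      if "length \<eta> \<le> length \<xi>" for e f \<eta>
      using less[of \<eta>] that Cons by simp
    show ?thesis
    proof (cases x)
      case (Some i)
      then show ?thesis
        by (simp add: Cons scomp_Some shuffle_Cons lderiv_shuffle scomp_add lderiv_scomp_Some IH)
    next
      case None
      have "shuffle (comp_of d i) (scomp (lderiv (Some i) (shuffle a b)) d) \<xi> =
          shuffle (comp_of d i) (\<lambda>\<eta>. shuffle (scomp (lderiv (Some i) a) d) (scomp b d) \<eta> +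
             shuffle (scomp a d) (scomp (lderiv (Some i) b) d) \<eta>) \<xi>" for i
        by (rule shuffle_cong) (simp_all add: lderiv_shuffle scomp_add IH)
      then show ?thesis
        by (simp add: Cons None scomp_None shuffle_Cons lderiv_scomp_None shuffle_add_left
            shuffle_add_right shuffle_sum_left shuffle_sum_right[where w = "\<lambda>_. 1", simplified]
            lderiv_shuffle scomp_add IH sum.distrib shuffle_assoc
            shuffle_left_commute[of "scomp a d"])
    qed
  qed
qed

text \<open>Here \<open>h\<close> is the product of \<open>d\<close> and \<open>e\<close> in
  \<open>delta_group\<close>. At x_0 the inner and the outer composition contribute shuffles with
  \<open>scomp (comp_of d i) e\<close> and with \<open>e\<close>, which add up to shuffles with
  \<open>h\<close>.\<close>

lemma scomp_assoc:
  assumes h: "\<And>i \<eta>. h \<eta> $ i = e \<eta> $ i + scomp (comp_of d i) e \<eta>"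
  shows "scomp (scomp a d) e \<zeta> = scomp a h \<zeta>"
proof (induction "length \<zeta>" arbitrary: a \<zeta> rule: less_induct)
  case less
  show ?case
  proof (cases \<zeta>)
    case Nil
    then show ?thesis by (simp add: scomp_Nil)
  next
    case (Cons x \<xi>)
    have IH: "scomp (scomp b d) e \<eta> = scomp b h \<eta>" if "length \<eta> \<le> length \<xi>" for b \<eta>
      using less[of \<eta>] that Cons by simp
    show ?thesis
    proof (cases x)
      case (Some i)
      then show ?thesis by (simp add: Cons scomp_Some lderiv_scomp_Some IH)
    next
      case None
      have 1: "shuffle f (scomp (scomp b d) e) \<xi> = shuffle f (scomp b h) \<xi>" for f b
        by (rule shuffle_cong) (simp_all add: IH)
      show ?thesis
        by (simp add: Cons None scomp_None lderiv_scomp_None lderiv_scomp_Some scomp_add scomp_sum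
            scomp_shuffle IH 1 h shuffle_add_left sum.distrib)
    qed
  qed
qed

text \<open>
  The left inverse of \<open>\<delta> + d\<close> solves \<open>scomp v d = w\<close> with \<open>w = - d\<^sub>i\<close>. Taking left derivatives turns this
  equation for \<open>v\<close> into one of the same shape for \<open>lderiv x v\<close>, so \<open>v\<close> is found by recursion on the word.
\<close>

primrec scomp_solve :: "('m::finite) series \<Rightarrow> 'm word \<Rightarrow> 'm sseries \<Rightarrow> real" where
  "scomp_solve d [] = (\<lambda>w. w [])"
| "scomp_solve d (x # \<eta>) = (\<lambda>w. scomp_solve d \<eta> (case x of Some i \<Rightarrow> lderiv (Some i) w
     | None \<Rightarrow> (\<lambda>\<zeta>. lderiv None w \<zeta> -
         (\<Sum>i\<in>UNIV. shuffle (comp_of d i) (lderiv (Some i) w) \<zeta>))))"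

lemma scomp_scomp_solve: "scomp (\<lambda>\<eta>. scomp_solve d \<eta> w) d \<zeta> = w \<zeta>"
proof (induction "length \<zeta>" arbitrary: w \<zeta> rule: less_induct)
  case less
  show ?case
  proof (cases \<zeta>)
    case Nil
    then show ?thesis by (simp add: scomp_Nil)
  next
    case (Cons x \<xi>)
    have IH: "scomp (\<lambda>\<eta>. scomp_solve d \<eta> v) d \<eta> = v \<eta>" if "length \<eta> \<le> length \<xi>" for v \<eta>
      using less[of \<eta>] that Cons by simp
    have ld: "lderiv (Some i) (\<lambda>\<eta>. scomp_solve d \<eta> w) = (\<lambda>\<eta>. scomp_solve d \<eta> (lderiv (Some i) w))"
      for i by (simp add: lderiv_def)
    show ?thesis
    proof (cases x)
      case (Some i)
      then show ?thesis by (simp add: Cons scomp_Some ld IH) (simp add: lderiv_def)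
    next
      case None
      have 1: "shuffle f (scomp (\<lambda>\<eta>. scomp_solve d \<eta> v) d) \<xi> = shuffle f v \<xi>" for f v
        by (rule shuffle_cong) (simp_all add: IH)
      have "lderiv None (\<lambda>\<eta>. scomp_solve d \<eta> w) = (\<lambda>\<eta>. scomp_solve d \<eta> (\<lambda>\<zeta>. lderiv None w \<zeta> -
         (\<Sum>i\<in>UNIV. shuffle (comp_of d i) (lderiv (Some i) w) \<zeta>)))"
        unfolding lderiv_def[of None "\<lambda>\<eta>. scomp_solve d \<eta> w"] by simp
      then show ?thesis
        by (simp add: Cons None scomp_None ld 1 IH) (simp add: lderiv_def)
    qed
  qed
qed

text \<open>\<open>scomp_scomp_solve\<close> supplies left inverses; group theory makes them right
  inverses, which is the form that yields the fixed point equation.\<close>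

lemma group_delta_group: "group (delta_group :: ('m::finite) series monoid)"
proof (rule groupI)
  let ?G = "delta_group :: 'm series monoid"
  fix x y z :: "'m series"
  show "x \<otimes>\<^bsub>?G\<^esub> y \<in> carrier ?G" "\<one>\<^bsub>?G\<^esub> \<in> carrier ?G"
    by (simp_all add: delta_group_def)
  show "\<one>\<^bsub>?G\<^esub> \<otimes>\<^bsub>?G\<^esub> x = x"
    by (simp add: delta_group_def mod_comp_component vec_eq_iff fun_eq_iff scomp_eq_sum[OF order_refl])
  have "mod_comp (\<lambda>\<eta>. y \<eta> + mod_comp x y \<eta>) z \<zeta> = mod_comp y z \<zeta> + mod_comp x (\<lambda>\<eta>. z \<eta> + mod_comp y z \<eta>) \<zeta>" for \<zeta>
    using scomp_assoc[of "\<lambda>\<eta>. z \<eta> + mod_comp y z \<eta>" z y]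
    by (simp add: vec_eq_iff mod_comp_component scomp_add)
  then show "x \<otimes>\<^bsub>?G\<^esub> y \<otimes>\<^bsub>?G\<^esub> z = x \<otimes>\<^bsub>?G\<^esub> (y \<otimes>\<^bsub>?G\<^esub> z)"
    by (simp add: delta_group_def add.assoc)
  have "(\<lambda>\<eta>. \<chi> i. scomp_solve x \<eta> (\<lambda>\<eta>. - x \<eta> $ i)) \<otimes>\<^bsub>?G\<^esub> x = \<one>\<^bsub>?G\<^esub>"
    by (simp add: delta_group_def mod_comp_component vec_eq_iff fun_eq_iff scomp_scomp_solve)
  then show "\<exists>y\<in>carrier ?G. y \<otimes>\<^bsub>?G\<^esub> x = \<one>\<^bsub>?G\<^esub>"
    by (intro bexI) (auto simp: delta_group_def)
qed

text \<open>The fixed point equation for the inverse, through which all later estimates access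
  \<open>comp_inverse\<close>.\<close>

lemma comp_inverse_eq: "comp_inverse c \<zeta> $ i = scomp (\<lambda>\<eta>. - c \<eta> $ i) (comp_inverse c) \<zeta>"
proof -
  have "c \<otimes>\<^bsub>delta_group\<^esub> comp_inverse c = \<one>\<^bsub>delta_group\<^esub>"
    unfolding comp_inverse_def
    by (rule group.r_inv[OF group_delta_group]) (simp add: delta_group_def)
  then have "comp_inverse c \<zeta> + mod_comp c (comp_inverse c) \<zeta> = 0"
    by (simp add: delta_group_def fun_eq_iff)
  then have "(comp_inverse c \<zeta> + mod_comp c (comp_inverse c) \<zeta>) $ i = 0 $ i"
    by (rule arg_cong)
  then show ?thesis by (simp add: mod_comp_component scomp_uminus)
qed

subsection \<open>The majorant series\<close>

text \<open>
  \<open>majorant m K M k n\<close> is the coefficient of \<open>x\<^sub>0\<^sup>n\<close> in \<open>scomp c\<^sub>k y\<close>, where \<open>c\<^sub>k\<close> is the \<open>k\<close>-th left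
  derivative of \<open>\<Sum> K M\<^bsup>|\<eta>|\<^esup> |\<eta>|! \<eta>\<close> and all components of \<open>y\<close> equal \<open>scomp c\<^sub>0 y\<close>.
\<close>

function majorant :: "nat \<Rightarrow> real \<Rightarrow> real \<Rightarrow> nat \<Rightarrow> nat \<Rightarrow> real" where
  "majorant m K M k 0 = K * M ^ k * fact k"
| "majorant m K M k (Suc n) = majorant m K M (Suc k) n +
     real m * (\<Sum>j\<le>n. real (n choose j) * majorant m K M 0 j * majorant m K M (Suc k) (n - j))"
  by pat_completeness auto
termination by (relation "Wellfounded.measure (\<lambda>(m, K, M, k, n). n)") auto

lemma majorant_nonneg:
  assumes "K \<ge> 0" "M \<ge> 0"
  shows "majorant m K M k n \<ge> 0"
  using assms
proof (induction n arbitrary: k rule: less_induct)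
  case (less n)
  then show ?case
    by (cases n) (auto intro!: add_nonneg_nonneg mult_nonneg_nonneg sum_nonneg)
qed

text \<open>Leibniz rule for binomial convolutions, by Pascal's identity; it mirrors
  \<open>shuffle_Cons\<close>.\<close>

lemma binomial_sum_Suc:
  fixes A B :: "nat \<Rightarrow> real"
  shows "(\<Sum>j\<le>n. real (n choose j) * A (Suc j) * B (n - j)) +
         (\<Sum>j\<le>n. real (n choose j) * A j * B (Suc (n - j))) =
         (\<Sum>j\<le>Suc n. real (Suc n choose j) * A j * B (Suc n - j))"
proof -
  have "(\<Sum>j\<le>n. real (n choose j) * A j * B (Suc (n - j))) =
      (\<Sum>j\<le>Suc n. real (n choose j) * A j * B (Suc n - j))"
    by (auto intro!: sum.cong simp: Suc_diff_le)
  also have "\<dots> = A 0 * B (Suc n) + (\<Sum>j\<le>n. real (n choose Suc j) * A (Suc j) * B (n - j))"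
    by (subst sum.atMost_Suc_shift) simp
  finally have 1: "(\<Sum>j\<le>n. real (n choose j) * A j * B (Suc (n - j))) =
      A 0 * B (Suc n) + (\<Sum>j\<le>n. real (n choose Suc j) * A (Suc j) * B (n - j))" .
  have "(\<Sum>j\<le>Suc n. real (Suc n choose j) * A j * B (Suc n - j)) =
      A 0 * B (Suc n) + (\<Sum>j\<le>n. real (Suc n choose Suc j) * A (Suc j) * B (n - j))"
    by (subst sum.atMost_Suc_shift) simp
  then show ?thesis
    by (simp only: 1) (simp add: sum.distrib distrib_right)
qed

text \<open>The \<open>j\<close> letters taken from the first factor can be placed in
  \<open>n choose j\<close> ways within a word of length \<open>n\<close>.\<close>

lemma abs_shuffle_le:
  fixes e f :: "('m::finite) sseries"
  assumes "\<And>\<eta>. length \<eta> \<le> length \<zeta> \<Longrightarrow> \<bar>e \<eta>\<bar> \<le> A (length \<eta>)"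
    and "\<And>\<eta>. length \<eta> \<le> length \<zeta> \<Longrightarrow> \<bar>f \<eta>\<bar> \<le> B (length \<eta>)"
  shows "\<bar>shuffle e f \<zeta>\<bar> \<le>
    (\<Sum>j\<le>length \<zeta>. real (length \<zeta> choose j) * A j * B (length \<zeta> - j))"
  using assms
proof (induction \<zeta> arbitrary: e f A B)
  case Nil
  then have "\<bar>e []\<bar> * \<bar>f []\<bar> \<le> A 0 * B 0"
    by (intro mult_mono) (force intro: order_trans[OF abs_ge_zero])+
  then show ?case by (simp add: shuffle_Nil abs_mult)
next
  case (Cons x \<zeta>)
  let ?n = "length \<zeta>"
  have "\<bar>shuffle (lderiv x e) f \<zeta>\<bar> \<le> (\<Sum>j\<le>?n. real (?n choose j) * A (Suc j) * B (?n - j))"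
    using Cons.prems(1)[of "x # _"] Cons.prems(2)
    by (intro Cons.IH[of _ "\<lambda>j. A (Suc j)"]) (simp_all add: lderiv_def)
  moreover have "\<bar>shuffle e (lderiv x f) \<zeta>\<bar> \<le> (\<Sum>j\<le>?n. real (?n choose j) * A j * B (Suc (?n - j)))"
    using Cons.prems(1) Cons.prems(2)[of "x # _"]
    by (intro Cons.IH[of _ _ _ "\<lambda>j. B (Suc j)"]) (simp_all add: lderiv_def)
  ultimately show ?case
    using binomial_sum_Suc[of ?n A B] by (simp add: shuffle_Cons)
qed

text \<open>On powers of one letter the count behind \<open>abs_shuffle_le\<close> becomes an exact
  formula.\<close>

lemma shuffle_replicate:
  fixes e f :: "('m::finite) sseries"
  shows "shuffle e f (replicate n x) =
    (\<Sum>j\<le>n. real (n choose j) * e (replicate j x) * f (replicate (n - j) x))"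
proof (induction n arbitrary: e f)
  case (Suc n)
  show ?case
    using binomial_sum_Suc[of n "\<lambda>j. e (replicate j x)" "\<lambda>j. f (replicate j x)"]
    by (simp add: shuffle_Cons Suc lderiv_def)
qed (simp add: shuffle_Nil)

text \<open>The recursion for left derivatives is estimated term by term. The level \<open>k\<close>
  varies in the induction because each derivative raises it by one.\<close>

lemma abs_scomp_le_majorant:
  fixes y :: "('m::finite) series"
  assumes K: "K \<ge> 0" and M: "M \<ge> 0"
    and c: "\<And>i \<eta>. \<bar>c i \<eta>\<bar> \<le> K * M ^ length \<eta> * fact (length \<eta>)"
    and y: "\<And>i \<eta>. y \<eta> $ i = scomp (c i) y \<eta>"
    and a: "\<And>\<eta>. \<bar>a \<eta>\<bar> \<le> K * M ^ (k + length \<eta>) * fact (k + length \<eta>)"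
  shows "\<bar>scomp a y \<zeta>\<bar> \<le> majorant CARD('m) K M k (length \<zeta>)"
  using a
proof (induction "length \<zeta>" arbitrary: a k \<zeta> rule: less_induct)
  case less
  show ?case
  proof (cases \<zeta>)
    case Nil
    then show ?thesis using less.prems[of "[]"] by (simp add: scomp_Nil)
  next
    case (Cons x \<xi>)
    let ?E = "majorant CARD('m) K M"
    have ld: "\<bar>lderiv b a \<eta>\<bar> \<le> K * M ^ (Suc k + length \<eta>) * fact (Suc k + length \<eta>)" for b \<eta>
      using less.prems[of "b # \<eta>"] by (simp add: lderiv_def)
    have IH: "\<bar>scomp (lderiv b a) y \<eta>\<bar> \<le> ?E (Suc k) (length \<eta>)" if "length \<eta> \<le> length \<xi>" for b \<eta>
      using less.hyps[of \<eta> "lderiv b a" "Suc k"] that Cons ld[of b] by simp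
    \<comment> \<open>By the fixed point equation \<open>y\<close> is itself a composition, covered
      by the same induction hypothesis at level 0.\<close>
    have yb: "\<bar>y \<eta> $ i\<bar> \<le> ?E 0 (length \<eta>)" if "length \<eta> \<le> length \<xi>" for i \<eta>
      using less.hyps[of \<eta> "c i" 0] that Cons c[of i] by (simp add: y[symmetric])
    have sh: "\<bar>shuffle (comp_of y i) (scomp (lderiv b a) y) \<xi>\<bar> \<le>
        (\<Sum>j\<le>length \<xi>. real (length \<xi> choose j) * ?E 0 j * ?E (Suc k) (length \<xi> - j))" for i b
      by (rule abs_shuffle_le) (simp_all add: IH yb)
    show ?thesis
    proof (cases x)
      case (Some i)
      \<comment> \<open>A letter other than x_0 produces only the first summand of the majorant
        recursion; the other one is dropped by sign.\<close>
      have "0 \<le> real CARD('m) * (\<Sum>j\<le>length \<xi>. real (length \<xi> choose j) * ?E 0 j * ?E (Suc k) (length \<xi> - j))"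
        by (intro mult_nonneg_nonneg sum_nonneg majorant_nonneg K M) auto
      then show ?thesis using IH[of \<xi> "Some i"] by (simp add: Cons Some scomp_Some)
    next
      case None
      have "\<bar>\<Sum>i\<in>UNIV. shuffle (comp_of y i) (scomp (lderiv (Some i) a) y) \<xi>\<bar> \<le>
         (\<Sum>i\<in>(UNIV::'m set). \<Sum>j\<le>length \<xi>. real (length \<xi> choose j) * ?E 0 j * ?E (Suc k) (length \<xi> - j))"
        by (intro order_trans[OF sum_abs] sum_mono sh)
      then show ?thesis using IH[of \<xi> None] by (simp add: Cons None scomp_None)
    qed
  qed
qed

text \<open>The left derivative of a series depending only on word length is the same for every
  letter, so along powers of x_0 the majorant recursion holds with equality.\<close>

lemma scomp_replicate_eq_majorant:
  fixes y :: "('m::finite) series"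
  assumes y: "\<And>i \<eta>. y \<eta> $ i = scomp (\<lambda>\<eta>. K * M ^ length \<eta> * fact (length \<eta>)) y \<eta>"
  shows "scomp (\<lambda>\<eta>. K * M ^ (k + length \<eta>) * fact (k + length \<eta>)) y (replicate n None) =
    majorant CARD('m) K M k n"
proof (induction n arbitrary: k rule: less_induct)
  case (less n)
  define a :: "nat \<Rightarrow> 'm sseries" where "a = (\<lambda>k \<eta>. K * M ^ (k + length \<eta>) * fact (k + length \<eta>))"
  have ld: "lderiv b (a k) = a (Suc k)" for b k
    by (simp add: lderiv_def a_def)
  have IH: "scomp (a k) y (replicate j None) = majorant CARD('m) K M k j" if "j < n" for j k
    using less[OF that] by (simp add: a_def)
  have "scomp (a k) y (replicate n None) = majorant CARD('m) K M k n"
  proof (cases n)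
    case 0
    then show ?thesis by (simp add: scomp_Nil a_def)
  next
    case (Suc l)
    have "y (replicate j None) $ i = majorant CARD('m) K M 0 j" if "j \<le> l" for i j
      using IH[of j 0] that Suc y by (simp add: a_def)
    then show ?thesis
      by (simp add: Suc scomp_None ld shuffle_replicate IH)
  qed
  then show ?case by (simp add: a_def)
qed

subsection \<open>The renewal equation\<close>

text \<open>
  An antiderivative of \<open>(1 - x) / (1 - x + \<kappa>)\<close>: a solution of \<open>(1 - p) p' = M (1 - p + \<kappa>)\<close> with
  \<open>p 0 = 0\<close> reaches the value \<open>x\<close> at time \<open>crit_time \<kappa> x / M\<close>.
\<close>

definition crit_time :: "real \<Rightarrow> real \<Rightarrow> real" where
  "crit_time \<kappa> x = x + \<kappa> * ln (1 - x + \<kappa>) - \<kappa> * ln (1 + \<kappa>)"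

lemma crit_time_0: "crit_time \<kappa> 0 = 0"
  by (simp add: crit_time_def)

lemma crit_time_1:
  assumes "\<kappa> > 0" shows "crit_time \<kappa> 1 = 1 - \<kappa> * ln (1 + 1 / \<kappa>)"
proof -
  have "1 + 1 / \<kappa> = (1 + \<kappa>) / \<kappa>" using assms by (simp add: field_simps)
  then show ?thesis using assms by (simp add: crit_time_def ln_div algebra_simps)
qed

lemma crit_time_1_pos:
  assumes "\<kappa> > 0" shows "crit_time \<kappa> 1 > 0"
proof -
  have "\<kappa> * ln (1 + 1 / \<kappa>) < \<kappa> * (1 / \<kappa>)"
    using assms ln_add_one_self_less_self[of "1 / \<kappa>"] by (intro mult_strict_left_mono) auto
  then show ?thesis using assms by (simp add: crit_time_1)
qed

lemma DERIV_crit_time: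
  assumes "\<kappa> > 0" "x \<le> 1"
  shows "(crit_time \<kappa> has_real_derivative (1 - x) / (1 - x + \<kappa>)) (at x)"
  unfolding crit_time_def [abs_def] using assms
  by (auto intro!: derivative_eq_intros simp: field_simps)

text \<open>The triangle \<open>i + j < n\<close> lies in a rectangle. The unequal upper ends fit
  the truncations of \<open>P\<close> and \<open>G\<close> in \<open>sum_P_le_1\<close>.\<close>

lemma sum_convolution_le:
  fixes a b :: "nat \<Rightarrow> real"
  assumes "\<And>n. a n \<ge> 0" "\<And>n. b n \<ge> 0"
  shows "(\<Sum>k<n. \<Sum>i\<le>k. a i * b (k - i)) \<le> (\<Sum>i\<le>n. a i) * (\<Sum>j<n. b j)"
proof -
  have "(\<Sum>k<n. \<Sum>i\<le>k. a i * b (k - i)) = (\<Sum>(i, j)\<in>{(i, j). i + j < n}. a i * b j)"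
    by (simp add: sum.triangle_reindex)
  also have "\<dots> \<le> (\<Sum>(i, j)\<in>{..n} \<times> {..<n}. a i * b j)"
    by (rule sum_mono2) (auto simp: assms)
  also have "\<dots> = (\<Sum>i\<le>n. a i) * (\<Sum>j<n. b j)"
    by (simp add: sum_product sum.cartesian_product)
  finally show ?thesis .
qed

lemma fps_conv_radius_ge:
  fixes F :: "real fps"
  assumes R: "R > 0" and F: "\<And>n. \<bar>fps_nth F n\<bar> \<le> C * R ^ n"
  shows "fps_conv_radius F \<ge> ereal (1 / R)"
  unfolding fps_conv_radius_def
proof (rule conv_radius_geI_ex)
  fix r :: real assume r: "0 < r" "ereal r < ereal (1 / R)"
  have "summable (\<lambda>n. C * (R * r) ^ n)"
    using r R by (intro summable_mult summable_geometric) (simp add: field_simps)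
  then have "summable (\<lambda>n. fps_nth F n * r ^ n)"
  proof (rule summable_comparison_test')
    fix n :: nat
    have "\<bar>fps_nth F n\<bar> * r ^ n \<le> C * R ^ n * r ^ n"
      using F r by (intro mult_right_mono) auto
    then show "norm (fps_nth F n * r ^ n) \<le> C * (R * r) ^ n"
      using r by (simp add: abs_mult power_mult_distrib mult_ac)
  qed
  then show "\<exists>z. norm z = r \<and> summable (\<lambda>n. fps_nth F n * z ^ n)"
    using r by (intro exI[of _ r]) auto
qed

text \<open>The system is stated for formal power series, before any convergence is known; signs and
  growth of coefficients enter with the individual results.\<close>

locale renewal =
  fixes \<kappa> M :: real and G P :: "real fps"
  assumes \<kappa>: "\<kappa> > 0" and M: "M > 0"
    and P0: "fps_nth P 0 = 0"
    and GP: "G * (1 - P) = fps_const \<kappa>"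
    and derivP: "fps_deriv P = fps_const M * (1 + G)"
begin

definition T :: real where "T = crit_time \<kappa> 1 / M"

lemma T_pos: "T > 0"
  using crit_time_1_pos[OF \<kappa>] M by (simp add: T_def)

lemma G_nth: "fps_nth G n = (if n = 0 then \<kappa> else 0) + (\<Sum>i\<le>n. fps_nth P i * fps_nth G (n - i))"
proof -
  have "G = fps_const \<kappa> + P * G" using GP by (simp add: algebra_simps)
  then have "fps_nth G n = fps_nth (fps_const \<kappa> + P * G) n" by simp
  then show ?thesis by (simp add: fps_mult_nth atLeast0AtMost)
qed

lemma P_nth_Suc: "real (Suc n) * fps_nth P (Suc n) = M * ((if n = 0 then 1 else 0) + fps_nth G n)"
  using arg_cong[OF derivP, of "\<lambda>f. fps_nth f n"] by simp

lemma P_nonneg: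
  assumes "\<And>n. fps_nth G n \<ge> 0"
  shows "fps_nth P n \<ge> 0"
proof (cases n)
  case (Suc k)
  have "real (Suc k) * fps_nth P (Suc k) \<ge> 0"
    unfolding P_nth_Suc using M assms by (intro mult_nonneg_nonneg add_nonneg_nonneg) auto
  then show ?thesis using Suc by (simp add: zero_le_mult_iff)
qed (simp add: P0)

text \<open>Polynomial truncations satisfy the differential equation as an inequality, so they
  cannot reach 1 before \<open>T\<close>; convergence of \<open>P\<close> at \<open>T\<close> is
  never presupposed.\<close>

lemma sum_P_le_1:
  assumes G: "\<And>n. fps_nth G n \<ge> 0"
  shows "(\<Sum>j\<le>Suc N. fps_nth P j * T ^ j) \<le> 1"
proof (rule ccontr)
  note P = P_nonneg[OF G]
  \<comment> \<open>\<open>q\<close> has one more degree than \<open>\<gamma>\<close>, which makes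
    \<open>q' = M (1 + \<gamma>)\<close> exact.\<close>
  define q where "q t = (\<Sum>j\<le>Suc N. fps_nth P j * t ^ j)" for t
  define \<gamma> where "\<gamma> t = (\<Sum>j<Suc N. fps_nth G j * t ^ j)" for t
  assume "\<not> (\<Sum>j\<le>Suc N. fps_nth P j * T ^ j) \<le> 1"
  then have qT: "q T > 1" by (simp add: q_def)
  have q0: "q 0 = 0"
    by (simp add: q_def P0 power_0_left sum.atMost_Suc_shift del: sum.atMost_Suc)
  have mono: "q s \<le> q t" if "0 \<le> s" "s \<le> t" for s t
    unfolding q_def using that by (intro sum_mono mult_left_mono power_mono P) auto
  have "isCont q t" for t unfolding q_def by (intro continuous_intros)
  then obtain t0 where t0: "0 \<le> t0" "t0 \<le> T" "q t0 = 1"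
    using IVT[of q 0 1 T] q0 qT T_pos by auto
  with qT have "t0 < T" by (cases "t0 = T") auto
  have dq: "(q has_real_derivative M * (1 + \<gamma> t)) (at t)" for t
  proof -
    have "(q has_real_derivative (\<Sum>j\<le>Suc N. fps_nth P j * (real j * t ^ (j - 1)))) (at t)"
      unfolding q_def
      by (auto intro!: derivative_eq_intros sum.cong simp: mult_ac simp del: sum.atMost_Suc)
    also have "(\<Sum>j\<le>Suc N. fps_nth P j * (real j * t ^ (j - 1))) =
        (\<Sum>j\<le>N. real (Suc j) * fps_nth P (Suc j) * t ^ j)"
      by (subst sum.atMost_Suc_shift) (simp add: mult_ac)
    also have "\<dots> = (\<Sum>j\<le>N. (if j = 0 then M * t ^ j else 0) + M * (fps_nth G j * t ^ j))"
      unfolding P_nth_Suc by (intro sum.cong) (auto simp: algebra_simps)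
    also have "\<dots> = M * (1 + \<gamma> t)"
      by (simp add: sum.distrib \<gamma>_def lessThan_Suc_atMost sum_distrib_left distrib_left)
    finally show ?thesis .
  qed
  \<comment> \<open>Truncating the identity \<open>G (1 - P) = \<kappa>\<close> loses only
    nonnegative terms, in the favourable direction.\<close>
  have \<gamma>q: "\<gamma> t * (1 - q t) \<le> \<kappa>" if "t \<ge> 0" for t
  proof -
    have "\<gamma> t = (\<Sum>j<Suc N. (if j = 0 then \<kappa> else 0) +
        (\<Sum>i\<le>j. (fps_nth P i * t ^ i) * (fps_nth G (j - i) * t ^ (j - i))))"
      unfolding \<gamma>_def
    proof (rule sum.cong)
      fix j
      have "fps_nth P i * fps_nth G (j - i) * t ^ j =
          (fps_nth P i * t ^ i) * (fps_nth G (j - i) * t ^ (j - i))" if "i \<le> j" for i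
        using power_add[of t i "j - i"] that by simp
      then show "fps_nth G j * t ^ j = (if j = 0 then \<kappa> else 0) +
          (\<Sum>i\<le>j. (fps_nth P i * t ^ i) * (fps_nth G (j - i) * t ^ (j - i)))"
        by (subst G_nth) (auto simp: distrib_right sum_distrib_right intro!: sum.cong)
    qed simp
    also have "\<dots> \<le> \<kappa> + q t * \<gamma> t"
      using sum_convolution_le[of "\<lambda>i. fps_nth P i * t ^ i" "\<lambda>i. fps_nth G i * t ^ i" "Suc N"] P G that
      by (simp add: sum.distrib q_def \<gamma>_def lessThan_Suc_atMost del: sum.atMost_Suc sum.lessThan_Suc)
    finally show ?thesis by (simp add: algebra_simps)
  qed
  \<comment> \<open>This difference is conserved along exact solutions; for the truncation it does
    not increase.\<close>
  have "crit_time \<kappa> (q t0) - M * t0 \<le> crit_time \<kappa> (q 0) - M * 0"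
  proof (rule DERIV_nonpos_imp_nonincreasing[OF t0(1)])
    fix t assume t: "0 \<le> t" "t \<le> t0"
    have qt: "q t \<le> 1" using mono[OF t] t0 by simp
    have "((\<lambda>t. crit_time \<kappa> (q t)) has_real_derivative
        (1 - q t) / (1 - q t + \<kappa>) * (M * (1 + \<gamma> t))) (at t)"
      by (rule DERIV_chain2[OF DERIV_crit_time[OF \<kappa> qt] dq])
    from DERIV_diff[OF this DERIV_cmult_Id[of M]]
    have "((\<lambda>t. crit_time \<kappa> (q t) - M * t) has_real_derivative
        (1 - q t) / (1 - q t + \<kappa>) * (M * (1 + \<gamma> t)) - M) (at t)" .
    moreover have "(1 - q t) * (1 + \<gamma> t) \<le> 1 - q t + \<kappa>"
      using \<gamma>q[OF t(1)] by (simp add: algebra_simps)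
    then have "M * ((1 - q t) * (1 + \<gamma> t)) \<le> M * (1 - q t + \<kappa>)"
      using M by (intro mult_left_mono) auto
    then have "(1 - q t) / (1 - q t + \<kappa>) * (M * (1 + \<gamma> t)) - M \<le> 0"
      using qt \<kappa> by (simp add: divide_simps mult_ac)
    ultimately show "\<exists>y. ((\<lambda>t. crit_time \<kappa> (q t) - M * t) has_real_derivative y) (at t) \<and> y \<le> 0"
      by blast
  qed
  then have "crit_time \<kappa> 1 \<le> M * t0" by (simp add: t0 q0 crit_time_0)
  then have "T \<le> t0" using M by (simp add: T_def field_simps)
  with \<open>t0 < T\<close> show False by simp
qed

text \<open>
  Since \<open>\<Sum> P\<^sub>j T\<^sup>j \<le> 1\<close>, the recursion for \<open>G\<^sub>n T\<^sup>n\<close> is a renewal equation. This gives the bound at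
  the critical constant itself, without an \<open>\<epsilon>\<close> loss.
\<close>

lemma G_bound:
  assumes G: "\<And>n. fps_nth G n \<ge> 0"
  shows "fps_nth G n * T ^ n \<le> \<kappa>"
proof (induction n rule: less_induct)
  case (less n)
  show ?case
  proof (cases n)
    case 0
    then show ?thesis using G_nth[of 0] P0 by simp
  next
    case (Suc N)
    have "fps_nth G n * T ^ n = (\<Sum>i\<le>n. fps_nth P i * fps_nth G (n - i) * T ^ n)"
      using Suc by (subst G_nth) (simp add: sum_distrib_right del: sum.atMost_Suc)
    also have "\<dots> \<le> (\<Sum>i\<le>n. fps_nth P i * T ^ i * \<kappa>)"
    proof (rule sum_mono)
      fix i assume "i \<in> {..n}"
      then have e: "T ^ n = T ^ i * T ^ (n - i)" using power_add[of T i "n - i"] by simp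
      show "fps_nth P i * fps_nth G (n - i) * T ^ n \<le> fps_nth P i * T ^ i * \<kappa>"
      \<comment> \<open>The term \<open>i = 0\<close> would involve \<open>G\<close> at
        \<open>n\<close> itself, outside the induction hypothesis; it vanishes because
        \<open>P\<close> has no constant term.\<close>
      proof (cases "i = 0")
        case False
        then have "(fps_nth P i * T ^ i) * (fps_nth G (n - i) * T ^ (n - i)) \<le> (fps_nth P i * T ^ i) * \<kappa>"
          using less[of "n - i"] Suc T_pos P_nonneg[OF G] by (intro mult_left_mono) auto
        then show ?thesis by (simp add: e mult_ac)
      qed (simp add: P0)
    qed
    also have "\<dots> = (\<Sum>i\<le>n. fps_nth P i * T ^ i) * \<kappa>" by (simp add: sum_distrib_right)
    also have "\<dots> \<le> 1 * \<kappa>"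
      using sum_P_le_1[OF G, of N] \<kappa> Suc by (intro mult_right_mono) auto
    finally show ?thesis by simp
  qed
qed

text \<open>
  A larger radius of convergence would let \<open>P\<close> reach \<open>1\<close> at a point not after \<open>T\<close>, where
  \<open>G (1 - P) = \<kappa>\<close> fails.
\<close>

lemma not_G_bound:
  assumes R: "R > 0" "R * T < 1"
  shows "\<not> (\<forall>n. \<bar>fps_nth G n\<bar> \<le> C * R ^ n)"
proof
  assume G: "\<forall>n. \<bar>fps_nth G n\<bar> \<le> C * R ^ n"
  have radG: "fps_conv_radius G \<ge> ereal (1 / R)"
    using fps_conv_radius_ge[OF R(1)] G by blast
  have rad1G: "fps_conv_radius (1 + G) \<ge> ereal (1 / R)"
    using fps_conv_radius_add[of 1 G] radG by (simp add: min_def split: if_splits)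
  have C: "C \<ge> 0" using G[rule_format, of 0] by simp
  \<comment> \<open>Dividing by \<open>R\<close> accounts for the index shift of integration;
    \<open>1 + C\<close> absorbs the constant in \<open>1 + G\<close>.\<close>
  have "\<bar>fps_nth P n\<bar> \<le> M * (1 + C) / R * R ^ n" for n
  proof (cases n)
    case (Suc k)
    have "\<bar>fps_nth P (Suc k)\<bar> \<le> \<bar>real (Suc k) * fps_nth P (Suc k)\<bar>"
      using mult_right_mono[of 1 "real (Suc k)" "\<bar>fps_nth P (Suc k)\<bar>"] by (simp add: abs_mult)
    also have "\<dots> \<le> M * ((if k = 0 then 1 else 0) + C * R ^ k)"
      unfolding P_nth_Suc abs_mult using M G[rule_format, of k]
      by (intro mult_mono) (auto intro: order_trans[OF abs_triangle_ineq])
    also have "\<dots> \<le> M * ((1 + C) * R ^ k)"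
      using M R by (intro mult_left_mono) (auto simp: algebra_simps)
    finally show ?thesis using Suc R by simp
  qed (use M C R in \<open>simp add: P0\<close>)
  then have radP: "fps_conv_radius P \<ge> ereal (1 / R)"
    using fps_conv_radius_ge[OF R(1)] by blast
  have rad1P: "fps_conv_radius (1 - P) \<ge> ereal (1 / R)"
    using fps_conv_radius_diff[of 1 P] radP by (simp add: min_def split: if_splits)
  define g where "g = eval_fps G"
  define p where "p = eval_fps P"
  have small: "ereal (norm t) < fps_conv_radius F"
    if "0 \<le> t" "t \<le> T" "ereal (1 / R) \<le> fps_conv_radius F" for t :: real and F :: "real fps"
  proof -
    have "R * t \<le> R * T" using that R by (intro mult_left_mono) auto
    then have "R * t < 1" using R by linarith
    then have "norm t < 1 / R" using that R by (simp add: field_simps)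
    then show ?thesis using that(3) by (metis ereal_less(2) less_ereal.simps(1) less_le_trans)
  qed
  have gp: "g t * (1 - p t) = \<kappa>" if "0 \<le> t" "t \<le> T" for t
  proof -
    have "eval_fps (G * (1 - P)) t = eval_fps G t * eval_fps (1 - P) t"
      using small[OF that] radG rad1P by (intro eval_fps_mult) auto
    also have "eval_fps (1 - P) t = 1 - p t"
      unfolding p_def using small[OF that] radP by (subst eval_fps_diff) auto
    finally show ?thesis by (simp add: GP g_def)
  qed
  have dp: "(p has_real_derivative M * (1 + g t)) (at t)" if "0 \<le> t" "t \<le> T" for t
  proof -
    have "(p has_real_derivative eval_fps (fps_deriv P) t) (at t)"
      unfolding p_def using small[OF that] radP by (intro has_field_derivative_eval_fps) auto
    also have "eval_fps (fps_deriv P) t = M * (1 + g t)"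
      unfolding derivP g_def using small[OF that] radG rad1G
      by (subst eval_fps_mult) (auto simp: eval_fps_add)
    finally show ?thesis .
  qed
  have p0: "p 0 = 0" by (simp add: p_def eval_fps_at_0 P0)
  have p1: "p t < 1" if t: "0 \<le> t" "t \<le> T" for t
  proof (rule ccontr)
    assume "\<not> p t < 1"
    moreover have "isCont p s" if "0 \<le> s" "s \<le> t" for s
      using dp[of s] that t DERIV_isCont by auto
    ultimately obtain s where s: "0 \<le> s" "s \<le> t" "p s = 1"
      using IVT[of p 0 1 t] p0 t by auto
    with gp[of s] t \<kappa> show False by simp
  qed
  \<comment> \<open>Conservation up to \<open>T\<close> forces \<open>crit_time\<close> to take its
    value at 1 already at \<open>p T < 1\<close>, against strict monotonicity.\<close>
  have "crit_time \<kappa> (p T) - M * T = crit_time \<kappa> (p 0) - M * 0"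
  proof (rule DERIV_isconst2[of 0 T "\<lambda>t. crit_time \<kappa> (p t) - M * t" T])
    have d: "((\<lambda>t. crit_time \<kappa> (p t) - M * t) has_real_derivative 0) (at t)"
      if t: "0 \<le> t" "t \<le> T" for t
    proof -
      have "((\<lambda>t. crit_time \<kappa> (p t)) has_real_derivative
          (1 - p t) / (1 - p t + \<kappa>) * (M * (1 + g t))) (at t)"
        using p1[OF t] by (intro DERIV_chain2[OF DERIV_crit_time[OF \<kappa>] dp[OF t]]) simp
      from DERIV_diff[OF this DERIV_cmult_Id[of M]]
      have "((\<lambda>t. crit_time \<kappa> (p t) - M * t) has_real_derivative
          (1 - p t) / (1 - p t + \<kappa>) * (M * (1 + g t)) - M) (at t)" .
      moreover have "(1 - p t) * (1 + g t) = 1 - p t + \<kappa>"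
        using gp[OF t] by (simp add: algebra_simps)
      then have "M * ((1 - p t) * (1 + g t)) = M * (1 - p t + \<kappa>)" by simp
      then have "(1 - p t) / (1 - p t + \<kappa>) * (M * (1 + g t)) - M = 0"
        using p1[OF t] \<kappa> by (simp add: divide_simps mult_ac)
      ultimately show ?thesis by simp
    qed
    then show "continuous_on {0..T} (\<lambda>t. crit_time \<kappa> (p t) - M * t)"
      by (meson DERIV_isCont atLeastAtMost_iff continuous_at_imp_continuous_on)
    show "((\<lambda>t. crit_time \<kappa> (p t) - M * t) has_real_derivative 0) (at t)"
      if "0 < t" "t < T" for t using d that by simp
  qed (use T_pos in auto)
  then have "crit_time \<kappa> (p T) = crit_time \<kappa> 1"
    using M by (simp add: p0 crit_time_0 T_def)
  moreover have "crit_time \<kappa> (p T) < crit_time \<kappa> 1"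
  \<comment> \<open>The derivative of \<open>crit_time \<kappa>\<close> vanishes at 1, so positivity
    is used on the open interval only.\<close>
  proof (rule DERIV_pos_imp_increasing_open[where f = "crit_time \<kappa>"])
    show "p T < 1" using p1[of T] T_pos by simp
    show "\<exists>y. (crit_time \<kappa> has_real_derivative y) (at x) \<and> 0 < y" if "p T < x" "x < 1" for x
      using that \<kappa> DERIV_crit_time[of \<kappa> x] by (intro exI[of _ "(1 - x) / (1 - x + \<kappa>)"]) auto
    show "continuous_on {p T..1} (crit_time \<kappa>)"
      using DERIV_crit_time[OF \<kappa>]
      by (meson DERIV_isCont atLeastAtMost_iff continuous_at_imp_continuous_on)
  qed
  ultimately show False by simp
qed

end

subsection \<open>Growth of the composition inverse\<close>

text \<open>Dividing by factorials turns the binomial convolution of the recursion into a product of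
  power series.\<close>

lemma fps_deriv_majorant:
  fixes K M :: real and m :: nat
  defines "f \<equiv> \<lambda>k. Abs_fps (\<lambda>n. majorant m K M k n / fact n)"
  shows "fps_deriv (f k) = f (Suc k) * (1 + fps_const (real m) * f 0)"
proof (rule fps_ext)
  fix n
  have "real (Suc n) * (x / fact (Suc n)) = x / fact n" for x
    unfolding fact_Suc of_nat_mult by (simp del: of_nat_Suc)
  then have "fps_nth (fps_deriv (f k)) n = majorant m K M k (Suc n) / fact n"
    by (simp add: f_def del: majorant.simps fact_Suc of_nat_Suc)
  also have "\<dots> = majorant m K M (Suc k) n / fact n + real m *
      (\<Sum>j\<le>n. real (n choose j) / fact n * (majorant m K M 0 j * majorant m K M (Suc k) (n - j)))"
    by (simp add: add_divide_distrib mult.assoc flip: sum_divide_distrib)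
  also have "(\<Sum>j\<le>n. real (n choose j) / fact n * (majorant m K M 0 j * majorant m K M (Suc k) (n - j)))
      = (\<Sum>j\<le>n. (majorant m K M 0 j / fact j) * (majorant m K M (Suc k) (n - j) / fact (n - j)))"
    by (rule sum.cong) (simp_all add: binomial_fact)
  also have "\<dots> = fps_nth (f 0 * f (Suc k)) n"
    by (simp add: fps_mult_nth atLeast0AtMost f_def)
  also have "majorant m K M (Suc k) n / fact n + real m * \<dots> =
      fps_nth (f (Suc k) * (1 + fps_const (real m) * f 0)) n"
  proof -
    have "f (Suc k) * (1 + fps_const (real m) * f 0) = f (Suc k) + fps_const (real m) * (f 0 * f (Suc k))"
      by (simp add: algebra_simps)
    then show ?thesis by (simp add: f_def)
  qed
  finally show "fps_nth (fps_deriv (f k)) n = fps_nth (f (Suc k) * (1 + fps_const (real m) * f 0)) n" .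
qed

text \<open>The hierarchy \<open>f k' = f (Suc k) (1 + G)\<close> is solved by the explicit family
  \<open>F\<close>; comparing \<open>f 0\<close> with \<open>F 0\<close> closes the infinite system
  into \<open>G (1 - P) = \<kappa>\<close>.\<close>

lemma majorant_renewal:
  assumes m: "m > 0" and K: "K > 0" and M: "M > 0"
  defines "G \<equiv> Abs_fps (\<lambda>n. real m * (majorant m K M 0 n / fact n))"
  shows "renewal (real m * K) M G (fps_const M * fps_integral0 (1 + G))"
proof
  define f where "f = (\<lambda>k. Abs_fps (\<lambda>n. majorant m K M k n / fact n))"
  have G: "G = fps_const (real m) * f 0"
    by (simp add: G_def f_def fps_eq_iff)
  define P where "P = fps_const M * fps_integral0 (1 + G)"
  have P0: "fps_nth P 0 = 0" by (simp add: P_def)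
  have dP: "fps_deriv P = fps_const M * (1 + G)" by (simp add: P_def fps_deriv_fps_integral)
  \<comment> \<open>The time change \<open>s \<mapsto> P / M\<close> applied to the \<open>k\<close>-th derivative of \<open>K / (1 - M s)\<close>.\<close>
  define F where "F = (\<lambda>k. fps_const (K * M ^ k * fact k) * inverse (1 - P) ^ Suc k)"
  have dinv: "fps_deriv (inverse (1 - P)) = fps_const M * (1 + G) * inverse (1 - P) ^ 2"
    by (subst fps_inverse_deriv) (simp_all add: P0 dP)
  have dF: "fps_deriv (F k) = F (Suc k) * (1 + G)" for k
  proof -
    have "fps_deriv (F k) = fps_const (K * M ^ k * fact k) *
        (fps_const (real (Suc k)) * (fps_const M * (1 + G) * inverse (1 - P) ^ 2) * inverse (1 - P) ^ k)"
      by (simp add: F_def fps_deriv_power dinv del: power_Suc of_nat_Suc)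
    also have "\<dots> = (fps_const (K * M ^ k * fact k) * fps_const (real (Suc k)) * fps_const M) *
        inverse (1 - P) ^ Suc (Suc k) * (1 + G)"
      by (simp add: power2_eq_square mult_ac)
    also have "fps_const (K * M ^ k * fact k) * fps_const (real (Suc k)) * fps_const M =
        fps_const (K * M ^ Suc k * fact (Suc k))"
      by (simp add: mult_ac)
    finally show ?thesis by (simp add: F_def)
  qed
  \<comment> \<open>With \<open>G\<close> fixed the hierarchy is linear, and coefficient
    \<open>n\<close> at level \<open>k\<close> depends on smaller coefficients at level
    \<open>Suc k\<close>; equal constant terms then give uniqueness.\<close>
  have fF: "fps_nth (f k) n = fps_nth (F k) n" for k n
  proof (induction n arbitrary: k rule: less_induct)
    case (less n)
    show ?case
    proof (cases n)
      case 0
      have "fps_nth (inverse (1 - P) ^ Suc k) 0 = 1"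
        by (simp add: P0 fps_nth_power_0 del: power_Suc)
      then show ?thesis using 0 by (simp add: f_def F_def)
    next
      case (Suc l)
      have "fps_nth (fps_deriv (f k)) l = fps_nth (f (Suc k) * (1 + G)) l"
        using fps_deriv_majorant[of m K M k] by (simp add: f_def G)
      also have "\<dots> = fps_nth (F (Suc k) * (1 + G)) l"
        unfolding fps_mult_nth using less Suc by (intro sum.cong) auto
      also have "\<dots> = fps_nth (fps_deriv (F k)) l" by (simp add: dF)
      finally show ?thesis using Suc by simp
    qed
  qed
  then have "f 0 = F 0" by (simp add: fps_eq_iff)
  then have "G * (1 - P) = fps_const (real m) * fps_const K * (inverse (1 - P) * (1 - P))"
    by (simp add: G F_def mult.assoc)
  also have "inverse (1 - P) * (1 - P) = 1"
    by (rule inverse_mult_eq_1) (simp add: P0)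
  finally show "G * (1 - fps_const M * fps_integral0 (1 + G)) = fps_const (real m * K)"
    by (simp add: P_def)
  show "fps_deriv (fps_const M * fps_integral0 (1 + G)) = fps_const M * (1 + G)"
    using dP by (simp add: P_def)
qed (use m K M in simp_all)

lemma critical_time_eq:
  assumes "m > 0" "K > 0" "M > 0"
  shows "crit_time (real m * K) 1 / M = 1 / (inverse_growth_factor m K * M)"
    and "inverse_growth_factor m K > 0"
  using assms crit_time_1[of "real m * K"] crit_time_1_pos[of "real m * K"]
  by (simp_all add: inverse_growth_factor_def mult.assoc)

lemma majorant_le:
  assumes m: "m > 0" and K: "K > 0" and M: "M > 0"
  shows "majorant m K M 0 n \<le> K * (inverse_growth_factor m K * M) ^ n * fact n"
proof -
  let ?G = "Abs_fps (\<lambda>n. real m * (majorant m K M 0 n / fact n))"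
  let ?A = "inverse_growth_factor m K * M"
  interpret renewal "real m * K" M ?G "fps_const M * fps_integral0 (1 + ?G)"
    by (rule majorant_renewal[OF assms])
  have A: "?A > 0" using critical_time_eq(2)[OF assms] M by simp
  have "fps_nth ?G n * T ^ n \<le> real m * K"
    by (rule G_bound) (use K M in \<open>simp add: majorant_nonneg\<close>)
  then have "real m * (majorant m K M 0 n / (fact n * ?A ^ n)) \<le> real m * K"
    by (simp add: T_def critical_time_eq[OF assms] power_divide power_one_over)
  then have "majorant m K M 0 n / (fact n * ?A ^ n) \<le> K"
    using m by (simp only: mult_le_cancel_left_pos of_nat_0_less_iff)
  then have "majorant m K M 0 n \<le> K * (fact n * ?A ^ n)"
    using A by (simp only: pos_divide_le_eq fact_gt_zero mult_pos_pos zero_less_power)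
  then show ?thesis by (simp add: mult_ac)
qed

lemma not_majorant_le:
  assumes m: "m > 0" and K: "K > 0" and M: "M > 0"
    and R: "R > 0" "R < inverse_growth_factor m K * M"
  shows "\<exists>n. majorant m K M 0 n > C * R ^ n * fact n"
proof (rule ccontr)
  assume H: "\<not> ?thesis"
  let ?G = "Abs_fps (\<lambda>n. real m * (majorant m K M 0 n / fact n))"
  interpret renewal "real m * K" M ?G "fps_const M * fps_integral0 (1 + ?G)"
    by (rule majorant_renewal[OF m K M])
  have "T = 1 / (inverse_growth_factor m K * M)"
    by (simp add: T_def critical_time_eq[OF m K M])
  then have "R * T < 1"
    using R by (simp add: pos_divide_less_eq)
  moreover have "\<bar>fps_nth ?G n\<bar> \<le> (real m * C) * R ^ n" for n
  proof -
    have "majorant m K M 0 n / fact n \<le> C * R ^ n"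
      using H by (simp add: not_less field_simps)
    then have "real m * (majorant m K M 0 n / fact n) \<le> real m * (C * R ^ n)"
      by (intro mult_left_mono) auto
    moreover have "majorant m K M 0 n \<ge> 0" using K M by (simp add: majorant_nonneg)
    ultimately show ?thesis by (simp add: mult.assoc)
  qed
  ultimately show False using not_G_bound[OF R(1)] by blast
qed

section \<open>From the majorant back to the composition inverse\<close>

lemma growth_bound_iff:
  "growth_bound K M c \<longleftrightarrow> (\<forall>\<eta> i. \<bar>c \<eta> $ i\<bar> \<le> K * M ^ length \<eta> * fact (length \<eta>))"
proof -
  have "infnorm x \<le> B \<longleftrightarrow> (\<forall>i. \<bar>x $ i\<bar> \<le> B)" for x :: "real ^ 'a" and B
  proof
    show "\<forall>i. \<bar>x $ i\<bar> \<le> B" if "infnorm x \<le> B"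
      using that component_le_infnorm_cart[of x] order_trans by blast
    show "infnorm x \<le> B" if "\<forall>i. \<bar>x $ i\<bar> \<le> B"
      unfolding infnorm_cart using that by (intro cSup_least) auto
  qed
  then show ?thesis by (simp add: growth_bound_def)
qed

text \<open>The constant \<open>K\<close> of \<open>c\<close> survives unchanged: \<open>G\<close>
  is bounded by \<open>m K\<close>, and the majorant is \<open>G\<close> divided by
  \<open>m\<close>, up to factorials.\<close>

lemma growth_bound_comp_inverse:
  fixes c :: "('m::finite) series"
  assumes K: "K > 0" and M: "M > 0" and c: "growth_bound K M c"
  shows "growth_bound K (inverse_growth_factor CARD('m) K * M) (comp_inverse c)"
  unfolding growth_bound_iff
proof (intro allI)
  fix \<eta> and i :: 'm
  let ?y = "comp_inverse c"
  have "\<bar>scomp (\<lambda>\<eta>. - c \<eta> $ i) ?y \<eta>\<bar> \<le> majorant CARD('m) K M 0 (length \<eta>)"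
    by (rule abs_scomp_le_majorant[where c = "\<lambda>i \<eta>. - c \<eta> $ i"])
      (use K M c in \<open>simp_all add: growth_bound_iff comp_inverse_eq[symmetric]\<close>)
  also have "\<dots> \<le> K * (inverse_growth_factor CARD('m) K * M) ^ length \<eta> * fact (length \<eta>)"
    by (rule majorant_le) (use K M in simp_all)
  finally show "\<bar>?y \<eta> $ i\<bar> \<le> \<dots>" by (simp only: comp_inverse_eq)
qed

lemma growth_bound_comp_inverse_sharp:
  assumes K: "K > 0" and M: "M > 0"
    and R: "R > 0" "R < inverse_growth_factor CARD('m::finite) K * M"
  shows "\<exists>c :: 'm series. growth_bound K M c \<and> \<not> (\<exists>C>0. growth_bound C R (comp_inverse c))"
proof (intro exI conjI notI)
  \<comment> \<open>The minus sign cancels the one in \<open>comp_inverse_eq\<close>, so the inverse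
    attains the majorant on powers of x_0.\<close>
  define c :: "'m series" where "c = (\<lambda>\<eta>. \<chi> i. - (K * M ^ length \<eta> * fact (length \<eta>)))"
  show "growth_bound K M c"
    using K M by (simp add: growth_bound_iff c_def)
  assume "\<exists>C>0. growth_bound C R (comp_inverse c)"
  then obtain C where C: "growth_bound C R (comp_inverse c)" by blast
  obtain n where n: "majorant CARD('m) K M 0 n > C * R ^ n * fact n"
    using not_majorant_le[OF _ K M R, of C] by auto
  have y: "comp_inverse c \<eta> $ i = scomp (\<lambda>\<eta>. K * M ^ length \<eta> * fact (length \<eta>)) (comp_inverse c) \<eta>"
    for \<eta> i by (subst comp_inverse_eq) (simp add: c_def)
  have "comp_inverse c (replicate n None) $ i = majorant CARD('m) K M 0 n" for i
    using scomp_replicate_eq_majorant[OF y, of 0 n] y[of "replicate n None" i] by simp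
  moreover have "\<bar>comp_inverse c (replicate n None) $ i\<bar> \<le> C * R ^ n * fact n" for i
    using C[unfolded growth_bound_iff, rule_format, of "replicate n None" i] by simp
  ultimately show False using n by (metis abs_le_D1 not_less)
qed

theorem theorem6:
  shows "(\<forall>(c :: ('m::finite) series) Kc Mc. Kc > 0 \<and> Mc > 0 \<and> growth_bound Kc Mc c \<longrightarrow>
            (\<exists>K>0. growth_bound K (inverse_growth_factor CARD('m) Kc * Mc) (comp_inverse c)) \<and>
            comp_inverse c \<in> locally_convergent) \<and>
         (\<forall>Kc Mc M'. Kc > 0 \<and> Mc > 0 \<and> 0 < M' \<and> M' < inverse_growth_factor CARD('m) Kc * Mc \<longrightarrow>
            (\<exists>c :: 'm series. c \<in> locally_convergent \<and> growth_bound Kc Mc c \<and>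
               \<not> (\<exists>K>0. growth_bound K M' (comp_inverse c)))) \<and>
         (\<forall>Kc Mc. Kc > 0 \<and> Mc > 0 \<longrightarrow>
            has_radius_of_convergence (comp_inverse ` {c :: 'm series. growth_bound Kc Mc c})
              (1 / (inverse_growth_factor CARD('m) Kc * Mc * (real CARD('m) + 1))))"
proof (intro conjI allI impI; (elim conjE)?)
  fix c :: "'m series" and K M :: real
  assume K: "K > 0" and M: "M > 0" and c: "growth_bound K M c"
  have "inverse_growth_factor CARD('m) K * M > 0"
    using critical_time_eq(2)[OF _ K M, of "CARD('m)"] M by simp
  then show "\<exists>C>0. growth_bound C (inverse_growth_factor CARD('m) K * M) (comp_inverse c)"
    "comp_inverse c \<in> locally_convergent"
    using growth_bound_comp_inverse[OF K M c] K by (auto simp: locally_convergent_def)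
next
  fix K M R :: real
  assume "K > 0" "M > 0" "0 < R" "R < inverse_growth_factor CARD('m) K * M"
  then show "\<exists>c :: 'm series. c \<in> locally_convergent \<and> growth_bound K M c \<and>
      \<not> (\<exists>C>0. growth_bound C R (comp_inverse c))"
    using growth_bound_comp_inverse_sharp[of K M R, where 'm = 'm]
    by (auto simp: locally_convergent_def)
next
  fix K M :: real
  assume K: "K > 0" and M: "M > 0"
  let ?A = "inverse_growth_factor CARD('m) K * M"
  let ?C = "comp_inverse ` {c :: 'm series. growth_bound K M c}"
  have "?A > 0"
    using critical_time_eq(2)[OF _ K M, of "CARD('m)"] M by simp
  \<comment> \<open>The radius is defined through an attained minimum, so \<open>?A\<close> itself
    has to be valid, not merely every larger constant.\<close>
  then have "geometric_constant ?C ?A"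
    using growth_bound_comp_inverse[OF K M] K by (auto simp: geometric_constant_def)
  moreover have "?A \<le> R" if "geometric_constant ?C R" for R
    using that growth_bound_comp_inverse_sharp[of K M R, where 'm = 'm] K M
    by (force simp: geometric_constant_def not_le[symmetric])
  ultimately show "has_radius_of_convergence ?C (1 / (?A * (real CARD('m) + 1)))"
    by (auto simp: has_radius_of_convergence_def)
qed

end
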